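(* Let $(\mathcal K,[\cdot,\cdot])$ be a Krein space and let $T$ be a closed, densely defined linear operator in $\mathcal K$ with Krein space adjoint $T^{[*]}$. If $\rho(T^{[*]}T)\neq\emptyset$ and $\rho(TT^{[*]})\neq\emptyset$, then $T^{[*]}T$ and $TT^{[*]}$ are (densely defined and) selfadjoint operators in the Krein space $\mathcal K$, i.e. $(T^{[*]}T)^{[*]}=T^{[*]}T$ and $(TT^{[*]})^{[*]}=TT^{[*]}$.
   Context: $\mathcal K$ is equipped with any Banach (Hilbert) norm $\|\cdot\|$ for which $[\cdot,\cdot]$ is continuous (all such norms are equivalent). $T^{[*]}$ denotes the adjoint of $T$ with respect to $[\cdot,\cdot]$. Products have natural domains, e.g. $\operatorname{dom}(T^{[*]}T)=\{x\in\operatorname{dom}T: Tx\in\operatorname{dom}T^{[*]}\}$. For an operator $S$ in $\mathcal K$, $\rho(S)$ is the set of $\lambda\in\mathbb C$ with $S-\lambda:\operatorname{dom}S\to\mathcal K$ bijective and $(S-\lambda)^{-1}$ bounded. *)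

theory Defs
  imports Complex_Main
begin

class cvector = ab_group_add +
  fixes cscale :: "complex \<Rightarrow> 'a \<Rightarrow> 'a"  (infixr \<open>*\<^sub>C\<close> 75)
  assumes cscale_add_right: "a *\<^sub>C (x + y) = a *\<^sub>C x + a *\<^sub>C y"
    and cscale_add_left: "(a + b) *\<^sub>C x = a *\<^sub>C x + b *\<^sub>C x"
    and cscale_cscale: "a *\<^sub>C (b *\<^sub>C x) = (a * b) *\<^sub>C x"
    and cscale_one: "1 *\<^sub>C x = x"

text \<open>A Krein space is a complex vector space with a Hermitian sesquilinear form
  (linear in the first, conjugate linear in the second argument) which admits a
  fundamental symmetry J: J is linear, J o J = id, J is selfadjoint w.r.t. the form,
  and the J-inner product [J x, y] is positive definite and complete.
  The topology of the Krein space is the one of the J-norm below (all Banach norms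
  making the form continuous are equivalent to it).\<close>

definition hermitian_sesq :: "('a::cvector \<Rightarrow> 'a \<Rightarrow> complex) \<Rightarrow> bool" where
  "hermitian_sesq f \<longleftrightarrow>
     (\<forall>a x y z. f (a *\<^sub>C x + y) z = a * f x z + f y z) \<and>
     (\<forall>x y. f x y = cnj (f y x))"

definition knorm :: "('a::cvector \<Rightarrow> 'a \<Rightarrow> complex) \<Rightarrow> ('a \<Rightarrow> 'a) \<Rightarrow> 'a \<Rightarrow> real" where
  "knorm f J x = sqrt (Re (f (J x) x))"

definition kconverges :: "('a::cvector \<Rightarrow> 'a \<Rightarrow> complex) \<Rightarrow> ('a \<Rightarrow> 'a) \<Rightarrow> (nat \<Rightarrow> 'a) \<Rightarrow> 'a \<Rightarrow> bool" where
  "kconverges f J X l \<longleftrightarrow> (\<lambda>n. knorm f J (X n - l)) \<longlonglongrightarrow> 0"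

definition kcauchy :: "('a::cvector \<Rightarrow> 'a \<Rightarrow> complex) \<Rightarrow> ('a \<Rightarrow> 'a) \<Rightarrow> (nat \<Rightarrow> 'a) \<Rightarrow> bool" where
  "kcauchy f J X \<longleftrightarrow> (\<forall>e>0. \<exists>N. \<forall>m\<ge>N. \<forall>n\<ge>N. knorm f J (X m - X n) < e)"

definition fundamental_symmetry :: "('a::cvector \<Rightarrow> 'a \<Rightarrow> complex) \<Rightarrow> ('a \<Rightarrow> 'a) \<Rightarrow> bool" where
  "fundamental_symmetry f J \<longleftrightarrow>
     (\<forall>a x y. J (a *\<^sub>C x + y) = a *\<^sub>C J x + J y) \<and>
     (\<forall>x. J (J x) = x) \<and>
     (\<forall>x y. f (J x) y = f x (J y)) \<and>
     (\<forall>x. x \<noteq> 0 \<longrightarrow> Re (f (J x) x) > 0)"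

definition krein_space :: "('a::cvector \<Rightarrow> 'a \<Rightarrow> complex) \<Rightarrow> ('a \<Rightarrow> 'a) \<Rightarrow> bool" where
  "krein_space f J \<longleftrightarrow> hermitian_sesq f \<and> fundamental_symmetry f J \<and>
     (\<forall>X. kcauchy f J X \<longrightarrow> (\<exists>l. kconverges f J X l))"

section \<open>Operators in K, represented by their graphs\<close>

definition op_dom :: "('a \<times> 'a) set \<Rightarrow> 'a set" where
  "op_dom T = fst ` T"

definition linear_op :: "('a::cvector \<times> 'a) set \<Rightarrow> bool" where
  "linear_op T \<longleftrightarrow> (0, 0) \<in> T \<and>
     (\<forall>x w y v. (x, w) \<in> T \<longrightarrow> (y, v) \<in> T \<longrightarrow> (x + y, w + v) \<in> T) \<and>
     (\<forall>a x w. (x, w) \<in> T \<longrightarrow> (a *\<^sub>C x, a *\<^sub>C w) \<in> T) \<and>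
     (\<forall>w. (0, w) \<in> T \<longrightarrow> w = 0)"

definition closed_op :: "('a::cvector \<Rightarrow> 'a \<Rightarrow> complex) \<Rightarrow> ('a \<Rightarrow> 'a) \<Rightarrow> ('a \<times> 'a) set \<Rightarrow> bool" where
  "closed_op f J T \<longleftrightarrow> (\<forall>X W x w. (\<forall>n. (X n, W n) \<in> T) \<longrightarrow> kconverges f J X x \<longrightarrow>
      kconverges f J W w \<longrightarrow> (x, w) \<in> T)"

definition densely_defined :: "('a::cvector \<Rightarrow> 'a \<Rightarrow> complex) \<Rightarrow> ('a \<Rightarrow> 'a) \<Rightarrow> ('a \<times> 'a) set \<Rightarrow> bool" where
  "densely_defined f J T \<longleftrightarrow> (\<forall>x e. e > 0 \<longrightarrow> (\<exists>d\<in>op_dom T. knorm f J (x - d) < e))"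

definition kadj :: "('a::cvector \<Rightarrow> 'a \<Rightarrow> complex) \<Rightarrow> ('a \<times> 'a) set \<Rightarrow> ('a \<times> 'a) set" where
  "kadj f T = {(y, z). \<forall>x w. (x, w) \<in> T \<longrightarrow> f w y = f x z}"

definition op_comp :: "('a \<times> 'a) set \<Rightarrow> ('a \<times> 'a) set \<Rightarrow> ('a \<times> 'a) set" where
  "op_comp B A = {(x, z). \<exists>y. (x, y) \<in> A \<and> (y, z) \<in> B}"

definition resolvent_set :: "('a::cvector \<Rightarrow> 'a \<Rightarrow> complex) \<Rightarrow> ('a \<Rightarrow> 'a) \<Rightarrow> ('a \<times> 'a) set \<Rightarrow> complex set" where
  "resolvent_set f J S = {l.
     (\<forall>y. \<exists>!x. \<exists>w. (x, w) \<in> S \<and> w - l *\<^sub>C x = y) \<and>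
     (\<exists>C. \<forall>x w. (x, w) \<in> S \<longrightarrow> knorm f J x \<le> C * knorm f J (w - l *\<^sub>C x))}"

end

theory Submission
  imports Defs "HOL-Library.Product_Plus"
begin

text \<open>On \<open>K \<times> K\<close> the block operator \<open>M (x, y) = (T\<^sup>* y, T x)\<close>, with \<open>T\<^sup>*\<close> the Krein space adjoint,
  is selfadjoint because \<open>T\<^sup>*\<^sup>* = T\<close>, and \<open>M\<^sup>2\<close> is the diagonal operator with entries \<open>T\<^sup>* T\<close> and
  \<open>T T\<^sup>*\<close>. The two products have a common regular point \<open>l = \<mu>\<^sup>2\<close>, so \<open>M - \<mu>\<close> and \<open>M + \<mu>\<close> are
  bijective. For the selfadjoint operator \<open>M\<close> this makes \<open>M - cnj \<mu>\<close> and \<open>M + cnj \<mu>\<close> surjective,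
  hence \<open>T\<^sup>* T - cnj l\<close> and \<open>T T\<^sup>* - cnj l\<close> are surjective too. A symmetric operator \<open>A\<close> with both
  \<open>A - l\<close> and \<open>A - cnj l\<close> surjective is densely defined and selfadjoint.\<close>

section \<open>Hilbert space geometry of a Krein space\<close>

lemma cscale_zero_left [simp]: "0 *\<^sub>C (x::'a::cvector) = 0"
  using cscale_add_left[of 0 0 x] by simp

lemma cscale_zero_right [simp]: "a *\<^sub>C (0::'a::cvector) = 0"
  using cscale_add_right[of a 0 0] by simp

lemma cscale_minus_left: "(- a) *\<^sub>C (x::'a::cvector) = - (a *\<^sub>C x)"
  using cscale_add_left[of a "- a" x] by (simp add: eq_neg_iff_add_eq_0 add.commute)

lemma cscale_minus_right: "a *\<^sub>C (- (x::'a::cvector)) = - (a *\<^sub>C x)"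
  using cscale_add_right[of a x "- x"] by (simp add: eq_neg_iff_add_eq_0 add.commute)

lemma cscale_diff_left: "(a - b) *\<^sub>C (x::'a::cvector) = a *\<^sub>C x - b *\<^sub>C x"
  using cscale_add_left[of a "- b" x] by (simp add: cscale_minus_left)

lemma cscale_diff_right: "a *\<^sub>C ((x::'a::cvector) - y) = a *\<^sub>C x - a *\<^sub>C y"
  using cscale_add_right[of a x "- y"] by (simp add: cscale_minus_right)

text \<open>One notion serves subspaces of K and, once pairs form a \<open>cvector\<close>, graphs
  of linear relations.\<close>

definition csubspace :: "'a::cvector set \<Rightarrow> bool" where
  "csubspace S \<longleftrightarrow> 0 \<in> S \<and> (\<forall>x\<in>S. \<forall>y\<in>S. x + y \<in> S) \<and> (\<forall>a. \<forall>x\<in>S. a *\<^sub>C x \<in> S)"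

text \<open>Regularity is split into \<open>op_surj\<close> and \<open>op_inj\<close> because the
  two halves pass between operators by different arguments. The relation \<open>H\<close> may be
  multivalued.\<close>

definition op_surj :: "complex \<Rightarrow> ('a::cvector \<times> 'a) set \<Rightarrow> bool" where
  "op_surj l H \<longleftrightarrow> (\<forall>y. \<exists>x w. (x, w) \<in> H \<and> w - l *\<^sub>C x = y)"

definition op_inj :: "complex \<Rightarrow> ('a::cvector \<times> 'a) set \<Rightarrow> bool" where
  "op_inj l H \<longleftrightarrow> (\<forall>x. (x, l *\<^sub>C x) \<in> H \<longrightarrow> x = 0)"

locale krein =
  fixes f :: "'a::cvector \<Rightarrow> 'a \<Rightarrow> complex" and J :: "'a \<Rightarrow> 'a"
  assumes krein: "krein_space f J"
begin

abbreviation nrm :: "'a \<Rightarrow> real" where "nrm \<equiv> knorm f J"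

text \<open>The Hilbert space inner product induced by the fundamental symmetry; its norm is
  \<open>nrm\<close>.\<close>

definition ip :: "'a \<Rightarrow> 'a \<Rightarrow> complex" where "ip x y = f (J x) y"

lemma herm: "f x y = cnj (f y x)"
  using krein unfolding krein_space_def hermitian_sesq_def by blast

lemma f_lin: "f (a *\<^sub>C x + y) z = a * f x z + f y z"
  using krein unfolding krein_space_def hermitian_sesq_def by blast

lemma f_add_left: "f (x + y) z = f x z + f y z"
  using f_lin[of 1 x y z] by (simp add: cscale_one)

lemma f_zero_left [simp]: "f 0 z = 0"
  using f_add_left[of 0 0 z] by simp

lemma f_scale_left: "f (a *\<^sub>C x) z = a * f x z"
  using f_lin[of a x 0 z] by simp

lemma f_diff_left: "f (x - y) z = f x z - f y z"
  using f_add_left[of "x - y" y z] by simp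

lemma f_add_right: "f z (x + y) = f z x + f z y"
  unfolding herm[of z] f_add_left by simp

lemma f_zero_right [simp]: "f z 0 = 0"
  using f_add_right[of z 0 0] by simp

lemma f_scale_right: "f z (a *\<^sub>C x) = cnj a * f z x"
  unfolding herm[of z] f_scale_left by simp

lemma f_diff_right: "f z (x - y) = f z x - f z y"
  using f_add_right[of z "x - y" y] by simp

lemma J_lin: "J (a *\<^sub>C x + y) = a *\<^sub>C J x + J y"
  and J_J [simp]: "J (J x) = x"
  and J_sym: "f (J x) y = f x (J y)"
  and J_pos: "x \<noteq> 0 \<Longrightarrow> 0 < Re (f (J x) x)"
  using krein unfolding krein_space_def fundamental_symmetry_def by blast+

lemma complete: "kcauchy f J X \<Longrightarrow> \<exists>l. kconverges f J X l"
  using krein unfolding krein_space_def by blast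

lemma J_add: "J (x + y) = J x + J y"
  using J_lin[of 1 x y] by (simp add: cscale_one)

lemma J_zero [simp]: "J 0 = 0"
  using J_add[of 0 0] by simp

lemma J_scale: "J (a *\<^sub>C x) = a *\<^sub>C J x"
  using J_lin[of a x 0] by simp

lemma J_diff: "J (x - y) = J x - J y"
  using J_add[of "x - y" y] by simp

lemma f_eq_ip: "f x y = ip (J x) y"
  by (simp add: ip_def)

lemma ip_herm: "ip x y = cnj (ip y x)"
  unfolding ip_def J_sym[of x y] by (rule herm)

lemma ip_scale_left: "ip (a *\<^sub>C x) z = a * ip x z"
  and ip_diff_left: "ip (x - y) z = ip x z - ip y z"
  and ip_scale_right: "ip z (a *\<^sub>C x) = cnj a * ip z x"
  and ip_diff_right: "ip z (x - y) = ip z x - ip z y"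
  and ip_zero_left [simp]: "ip 0 z = 0"
  and ip_zero_right [simp]: "ip z 0 = 0"
  by (simp_all add: ip_def J_scale J_diff f_scale_left f_diff_left f_scale_right f_diff_right)

lemma ip_self: "ip x x = of_real ((nrm x)\<^sup>2)"
proof -
  have "Im (ip x x) = 0"
    using ip_herm[of x x] by (metis complex_is_Real_iff Reals_cnj_iff)
  moreover have "0 \<le> Re (ip x x)"
    using J_pos[of x] by (cases "x = 0") (auto simp: ip_def)
  ultimately show ?thesis
    by (simp add: complex_eq_iff knorm_def ip_def)
qed

lemma nrm_zero [simp]: "nrm 0 = 0"
  by (simp add: knorm_def)

lemma nrm_nonneg [simp]: "0 \<le> nrm x"
  using J_pos[of x] by (cases "x = 0") (auto simp: knorm_def)

lemma nrm_eq_0_iff [simp]: "nrm x = 0 \<longleftrightarrow> x = 0"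
  using J_pos[of x] by (cases "x = 0") (auto simp: knorm_def)

lemma f_nondeg:
  assumes "\<And>y. f y x = 0" shows "x = 0"
  using assms[of "J x"] J_pos[of x] by (cases "x = 0") auto

lemma nrm_diff_scale:
  "(nrm (u - t *\<^sub>C s))\<^sup>2 = (nrm u)\<^sup>2 - 2 * Re (t * ip s u) + (cmod t)\<^sup>2 * (nrm s)\<^sup>2"
proof -
  have "ip (u - t *\<^sub>C s) (u - t *\<^sub>C s) = ip u u - (t * ip s u + cnj (t * ip s u)) + t * cnj t * ip s s"
    using ip_herm[of u s]
    by (simp add: ip_diff_left ip_diff_right ip_scale_left ip_scale_right algebra_simps)
  also have "\<dots> = of_real ((nrm u)\<^sup>2 - 2 * Re (t * ip s u) + (cmod t)\<^sup>2 * (nrm s)\<^sup>2)"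
    unfolding ip_self complex_add_cnj by (simp add: complex_norm_square[symmetric])
  finally show ?thesis
    unfolding ip_self of_real_eq_iff .
qed

lemma nrm_scale: "nrm (a *\<^sub>C x) = cmod a * nrm x"
proof -
  have "complex_of_real ((nrm (a *\<^sub>C x))\<^sup>2) = of_real ((cmod a * nrm x)\<^sup>2)"
    using ip_self[of "a *\<^sub>C x"] ip_self[of x]
    by (simp add: ip_scale_left ip_scale_right power_mult_distrib
        complex_norm_square[simplified] mult_ac)
  then have "(nrm (a *\<^sub>C x))\<^sup>2 = (cmod a * nrm x)\<^sup>2"
    unfolding of_real_eq_iff .
  then show ?thesis by (simp add: power2_eq_iff_nonneg)
qed

lemma nrm_minus: "nrm (- x) = nrm x"
  using nrm_scale[of "- 1" x] by (simp add: cscale_minus_left cscale_one)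

lemma nrm_minus_commute: "nrm (x - y) = nrm (y - x)"
  using nrm_minus[of "x - y"] by simp

text \<open>Minimality of the norm of \<open>u\<close> over the line \<open>u - t s\<close> is tested at
  \<open>t = cnj \<langle>s, u\<rangle> / \<parallel>s\<parallel>\<^sup>2\<close>; both the Cauchy-Schwarz inequality and the orthogonality of the
  nearest point come from this one computation.\<close>

lemma nrm_diff_optimal:
  assumes "s \<noteq> 0"
  shows "(nrm (u - (cnj (ip s u) / of_real ((nrm s)\<^sup>2)) *\<^sub>C s))\<^sup>2
    = (nrm u)\<^sup>2 - (cmod (ip s u))\<^sup>2 / (nrm s)\<^sup>2"
proof -
  let ?t = "cnj (ip s u) / of_real ((nrm s)\<^sup>2)"
  have n: "nrm s \<noteq> 0" using assms by simp
  have "?t * ip s u = of_real ((cmod (ip s u))\<^sup>2 / (nrm s)\<^sup>2)"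
    by (simp add: complex_norm_square[simplified] mult.commute)
  then have "Re (?t * ip s u) = (cmod (ip s u))\<^sup>2 / (nrm s)\<^sup>2"
    by (metis Re_complex_of_real)
  moreover have "(cmod ?t)\<^sup>2 * (nrm s)\<^sup>2 = (cmod (ip s u))\<^sup>2 / (nrm s)\<^sup>2"
    using n by (simp add: norm_divide power_divide power2_eq_square norm_mult)
  ultimately show ?thesis
    unfolding nrm_diff_scale by linarith
qed

lemma cauchy_schwarz: "cmod (ip x y) \<le> nrm x * nrm y"
proof (cases "x = 0")
  case False
  then have n: "nrm x > 0" using nrm_nonneg[of x] nrm_eq_0_iff[of x] by linarith
  have "(cmod (ip x y))\<^sup>2 / (nrm x)\<^sup>2 \<le> (nrm y)\<^sup>2"
    using nrm_diff_optimal[OF False, of y] by (metis zero_le_power2 diff_ge_0_iff_ge)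
  then have "(cmod (ip x y))\<^sup>2 \<le> (nrm x * nrm y)\<^sup>2"
    using False n pos_divide_le_eq[of "(nrm x)\<^sup>2"] by (simp add: power_mult_distrib mult.commute)
  then show ?thesis
    by (rule power2_le_imp_le) simp
qed simp

lemma nrm_diff_sq: "(nrm (x - y))\<^sup>2 = (nrm x)\<^sup>2 - 2 * Re (ip y x) + (nrm y)\<^sup>2"
  using nrm_diff_scale[of x 1 y] by (simp add: cscale_one)

lemma nrm_add_sq: "(nrm (x + y))\<^sup>2 = (nrm x)\<^sup>2 + 2 * Re (ip y x) + (nrm y)\<^sup>2"
  using nrm_diff_scale[of x "-1" y] by (simp add: cscale_one cscale_minus_left)

lemma nrm_triangle: "nrm (x + y) \<le> nrm x + nrm y"
proof (rule power2_le_imp_le)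
  have "Re (ip y x) \<le> nrm y * nrm x"
    using cauchy_schwarz[of y x] complex_Re_le_cmod[of "ip y x"] by linarith
  then show "(nrm (x + y))\<^sup>2 \<le> (nrm x + nrm y)\<^sup>2"
    unfolding nrm_add_sq by (simp add: power2_sum mult.commute)
qed simp

lemma nrm_triangle_diff: "nrm (x - z) \<le> nrm (x - y) + nrm (y - z)"
  using nrm_triangle[of "x - y" "y - z"] by simp

lemma nrm_J: "nrm (J x) = nrm x"
  by (simp add: knorm_def J_sym)

lemma f_bound: "cmod (f x y) \<le> nrm x * nrm y"
  using cauchy_schwarz[of "J x" y] by (simp add: f_eq_ip nrm_J)

lemma f_tendsto_right:
  assumes "kconverges f J X l" shows "(\<lambda>n. f z (X n)) \<longlonglongrightarrow> f z l"
proof -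
  have "(\<lambda>n. nrm z * nrm (X n - l)) \<longlonglongrightarrow> nrm z * 0"
    using assms unfolding kconverges_def by (rule tendsto_mult_left)
  then have "(\<lambda>n. nrm z * nrm (X n - l)) \<longlonglongrightarrow> 0" by simp
  moreover have "norm (f z (X n) - f z l) \<le> nrm z * nrm (X n - l)" for n
    unfolding f_diff_right[symmetric] by (rule f_bound)
  ultimately have "(\<lambda>n. f z (X n) - f z l) \<longlonglongrightarrow> 0"
    by (elim tendsto_0_le[where K = 1]) simp
  then show ?thesis by (rule LIM_zero_cancel)
qed

section \<open>Orthogonal projection and density\<close>

definition kclosed :: "'a set \<Rightarrow> bool" where
  "kclosed S \<longleftrightarrow> (\<forall>X l. (\<forall>n. X n \<in> S) \<longrightarrow> kconverges f J X l \<longrightarrow> l \<in> S)"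

text \<open>Closest-point theorem: a minimizing sequence is Cauchy by the parallelogram law, and
  minimality at its limit makes the residual orthogonal to \<open>S\<close>.\<close>

lemma projection:
  assumes S: "csubspace S"
    and cl: "kclosed S"
  obtains p where "p \<in> S" "\<And>s. s \<in> S \<Longrightarrow> ip s (x - p) = 0"
proof -
  define D where "D = Inf ((\<lambda>s. (nrm (x - s))\<^sup>2) ` S)"
  have ne: "S \<noteq> {}" using S by (auto simp: csubspace_def)
  have bdd: "bdd_below ((\<lambda>s. (nrm (x - s))\<^sup>2) ` S)"
    by (intro bdd_belowI2[where m = 0]) simp
  have low: "D \<le> (nrm (x - s))\<^sup>2" if "s \<in> S" for s
    unfolding D_def using bdd that by (intro cInf_lower) auto
  have "\<exists>s\<in>S. (nrm (x - s))\<^sup>2 < D + 1 / real (Suc n)" for n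
    using cInf_lessD[of "(\<lambda>s. (nrm (x - s))\<^sup>2) ` S" "D + 1 / real (Suc n)"] ne
    unfolding D_def by auto
  then obtain X where XS: "\<And>n. X n \<in> S" and X: "\<And>n. (nrm (x - X n))\<^sup>2 < D + 1 / real (Suc n)"
    by metis
  \<comment> \<open>The midpoint \<open>?h\<close> lies in \<open>S\<close>, so its squared distance
    to \<open>x\<close> is at least \<open>D\<close>; the parallelogram law turns this into an upper
    bound for the gap.\<close>
  have par: "(nrm (X m - X n))\<^sup>2 \<le> 2 / real (Suc m) + 2 / real (Suc n)" for m n
  proof -
    let ?h = "(1/2) *\<^sub>C (X m + X n)"
    let ?u = "x - X n" and ?v = "x - X m"
    have "?h \<in> S" using S XS by (auto simp: csubspace_def)
    then have "D \<le> (nrm (x - ?h))\<^sup>2" by (rule low)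
    moreover have "x - ?h = (1/2) *\<^sub>C (?u + ?v)"
      using cscale_add_left[of "1/2" "1/2" x]
      by (simp add: cscale_add_right cscale_diff_right cscale_one)
    then have "(nrm (x - ?h))\<^sup>2 = (nrm (?u + ?v))\<^sup>2 / 4"
      by (simp add: nrm_scale power_mult_distrib power_divide)
    moreover have "X m - X n = ?u - ?v" by simp
    ultimately show ?thesis
      using X[of m] X[of n] nrm_add_sq[of ?u ?v] nrm_diff_sq[of ?u ?v] by simp
  qed
  have "kcauchy f J X"
    unfolding kcauchy_def
  proof (intro allI impI)
    fix e :: real assume "e > 0"
    \<comment> \<open>Beyond \<open>N\<close> each of the two summands in \<open>par\<close> is
      below half of the squared \<open>e\<close>.\<close>
    then obtain N where N: "4 / e\<^sup>2 < real N"
      using reals_Archimedean2 by blast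
    have "nrm (X m - X n) < e" if "m \<ge> N" "n \<ge> N" for m n
    proof (rule power2_less_imp_less)
      have *: "2 / real (Suc k) < e\<^sup>2 / 2" if "k \<ge> N" for k
      proof -
        have "4 / e\<^sup>2 < real (Suc k)" using N that by simp
        then show ?thesis using \<open>e > 0\<close> by (simp add: field_simps)
      qed
      show "(nrm (X m - X n))\<^sup>2 < e\<^sup>2"
        using par[of m n] *[OF that(1)] *[OF that(2)] by linarith
    qed (use \<open>e > 0\<close> in simp)
    then show "\<exists>N. \<forall>m\<ge>N. \<forall>n\<ge>N. nrm (X m - X n) < e" by blast
  qed
  then obtain p where p: "kconverges f J X p" using complete by blast
  have pS: "p \<in> S" using cl XS p unfolding kclosed_def by blast
  have nD: "nrm (x - p) \<le> sqrt D"
  proof (rule LIMSEQ_le_const)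
    have "(\<lambda>n. sqrt (D + 1 / real (Suc n)) + nrm (X n - p)) \<longlonglongrightarrow> sqrt (D + 0) + 0"
      using p unfolding kconverges_def
      by (intro tendsto_intros LIMSEQ_Suc[OF lim_1_over_n]) auto
    then show "(\<lambda>n. sqrt (D + 1 / real (Suc n)) + nrm (X n - p)) \<longlonglongrightarrow> sqrt D" by simp
    have "nrm (x - p) \<le> sqrt (D + 1 / real (Suc n)) + nrm (X n - p)" for n
      using nrm_triangle_diff[of x p "X n"] real_le_rsqrt[OF less_imp_le[OF X[of n]]] by linarith
    then show "\<exists>N. \<forall>n\<ge>N. nrm (x - p) \<le> sqrt (D + 1 / real (Suc n)) + nrm (X n - p)" by blast
  qed
  have "D \<ge> 0" unfolding D_def using ne by (intro cInf_greatest) auto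
  then have nD: "(nrm (x - p))\<^sup>2 \<le> D"
    using power_mono[OF nD, of 2] by simp
  have "ip s (x - p) = 0" if s: "s \<in> S" for s
  proof (cases "s = 0")
    case False
    \<comment> \<open>Moving \<open>p\<close> by this optimal multiple of \<open>s\<close> would
      strictly shorten the distance to \<open>x\<close> unless \<open>ip s (x - p)\<close>
      vanishes.\<close>
    let ?t = "cnj (ip s (x - p)) / of_real ((nrm s)\<^sup>2)"
    have "p + ?t *\<^sub>C s \<in> S" using S pS s unfolding csubspace_def by blast
    then have "D \<le> (nrm ((x - p) - ?t *\<^sub>C s))\<^sup>2"
      using low by (simp add: diff_diff_eq)
    then have "(cmod (ip s (x - p)))\<^sup>2 / (nrm s)\<^sup>2 \<le> 0"
      using nD unfolding nrm_diff_optimal[OF False] by linarith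
    then show ?thesis
      using False by (simp add: divide_le_0_iff)
  qed simp
  with pS that show ?thesis by blast
qed

text \<open>Bipolar principle in terms of the indefinite form. If \<open>p\<close> is the nearest
  point to \<open>x\<close>, then \<open>J (x - p)\<close> is form-orthogonal to \<open>S\<close>,
  hence to \<open>x\<close>, and so [x - p, J (x - p)] = 0 forces x = p.\<close>

lemma f_projection:
  assumes S: "csubspace S"
    and cl: "kclosed S"
    and orth: "\<And>u. (\<And>s. s \<in> S \<Longrightarrow> f s u = 0) \<Longrightarrow> f x u = 0"
  shows "x \<in> S"
proof -
  obtain p where p: "p \<in> S" "\<And>s. s \<in> S \<Longrightarrow> ip s (x - p) = 0"
    using projection[OF S cl] by blast
  have o: "f s (J (x - p)) = 0" if "s \<in> S" for s
    using p(2)[OF that] by (simp add: ip_def J_sym)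
  have "f x (J (x - p)) = 0" by (rule orth[OF o])
  with o[OF p(1)] have "f (x - p) (J (x - p)) = 0"
    by (simp add: f_diff_left)
  then have "Re (f (J (x - p)) (x - p)) = 0" by (simp add: J_sym)
  then have "x - p = 0" using J_pos[of "x - p"] by (metis less_irrefl)
  then show ?thesis using p(1) by simp
qed

text \<open>Apply \<open>f_projection\<close> to the norm closure \<open>C\<close> of
  \<open>S\<close>: only zero is orthogonal to \<open>C\<close>, so \<open>C\<close> is the whole
  space.\<close>

lemma dense_of_trivial_orthogonal:
  assumes S: "csubspace S" and orth: "\<And>u. (\<And>s. s \<in> S \<Longrightarrow> f s u = 0) \<Longrightarrow> u = 0"
    and "e > 0"
  shows "\<exists>s\<in>S. nrm (x - s) < e"
proof -
  define C where "C = {x. \<forall>e>0. \<exists>s\<in>S. nrm (x - s) < e}"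
  have near: "\<exists>s\<in>S. nrm (x - s) < e" if "x \<in> C" "e > 0" for x e
    using that unfolding C_def by blast
  have SC: "S \<subseteq> C" unfolding C_def by (auto intro!: bexI)
  have "x \<in> C"
  proof (rule f_projection)
    show "csubspace C"
      unfolding csubspace_def
    proof (intro conjI ballI allI)
      show "0 \<in> C" using S SC by (auto simp: csubspace_def)
    next
      fix x y assume xy: "x \<in> C" "y \<in> C"
      show "x + y \<in> C"
        unfolding C_def
      proof (intro CollectI allI impI)
        fix e :: real assume "e > 0"
        then obtain s t where st: "s \<in> S" "nrm (x - s) < e/2" "t \<in> S" "nrm (y - t) < e/2"
          using near[OF xy(1), of "e/2"] near[OF xy(2), of "e/2"] by auto
        have "nrm (x + y - (s + t)) < e"
          using nrm_triangle[of "x - s" "y - t"] st by (simp add: algebra_simps)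
        moreover have "s + t \<in> S" using S st by (auto simp: csubspace_def)
        ultimately show "\<exists>s\<in>S. nrm (x + y - s) < e" by blast
      qed
    next
      fix a x assume x: "x \<in> C"
      show "a *\<^sub>C x \<in> C"
        unfolding C_def
      proof (intro CollectI allI impI)
        fix e :: real assume "e > 0"
        \<comment> \<open>The summand 1 keeps the divisor positive when
          \<open>a = 0\<close>.\<close>
        then have "e / (cmod a + 1) > 0" by (simp add: add_nonneg_pos)
        then obtain s where s: "s \<in> S" "nrm (x - s) < e / (cmod a + 1)"
          using x unfolding C_def by blast
        then have "(cmod a + 1) * nrm (x - s) < e"
          by (simp add: add_nonneg_pos pos_less_divide_eq mult.commute)
        then have "nrm (a *\<^sub>C x - a *\<^sub>C s) < e"
          using nrm_nonneg[of "x - s"]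
          unfolding cscale_diff_right[symmetric] nrm_scale distrib_right by linarith
        moreover have "a *\<^sub>C s \<in> S" using S s by (auto simp: csubspace_def)
        ultimately show "\<exists>s\<in>S. nrm (a *\<^sub>C x - s) < e" by blast
      qed
    qed
  next
    show "kclosed C"
      unfolding kclosed_def
    proof (intro allI impI)
      fix X l assume X: "\<forall>n. X n \<in> C" and l: "kconverges f J X l"
      show "l \<in> C"
        unfolding C_def
      proof (intro CollectI allI impI)
        fix e :: real assume "e > 0"
        then obtain n where n: "nrm (X n - l) < e/2"
          using l order_tendstoD(2)[of _ 0 sequentially "e/2"] unfolding kconverges_def
          by (auto simp: eventually_sequentially)
        obtain s where "s \<in> S" "nrm (X n - s) < e/2"
          using X near[of "X n" "e/2"] \<open>e > 0\<close> by auto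
        then show "\<exists>s\<in>S. nrm (l - s) < e"
          using n nrm_triangle_diff[of l s "X n"] nrm_minus_commute[of l "X n"] by force
      qed
    qed
  next
    fix u assume "\<And>s. s \<in> C \<Longrightarrow> f s u = 0"
    then have "u = 0" using SC orth by blast
    then show "f x u = 0" by simp
  qed
  then show ?thesis using \<open>e > 0\<close> unfolding C_def by blast
qed


section \<open>Uniform boundedness\<close>

text \<open>One hump. A vector \<open>e\<close> of norm \<open>r\<close> in the direction of
  \<open>J v\<close> has [e, v] = r ||v||. The values at x + e and x - e differ by twice this, so
  one of them is large enough.\<close>

lemma unit_step:
  assumes "v \<noteq> 0" "r \<ge> 0"
  shows "\<exists>x'. nrm (x' - x) \<le> r \<and> r * nrm v \<le> cmod (f x' v)"
proof -
  have n: "nrm v > 0"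
    using assms nrm_nonneg[of v] nrm_eq_0_iff[of v] by linarith
  define e where "e = (of_real (r / nrm v) :: complex) *\<^sub>C J v"
  have ne: "nrm e = r"
    using n assms by (simp add: e_def nrm_scale nrm_J norm_divide)
  have "f e v = of_real (r * nrm v)"
    using n ip_self[of v] by (simp add: e_def f_scale_left ip_def power2_eq_square)
  then have "of_real (2 * (r * nrm v)) = f (x + e) v - f (x - e) v"
    by (simp add: f_add_left f_diff_left)
  then have "cmod (of_real (2 * (r * nrm v))) \<le> cmod (f (x + e) v) + cmod (f (x - e) v)"
    by (metis norm_triangle_ineq4)
  then have "2 * (r * nrm v) \<le> cmod (f (x + e) v) + cmod (f (x - e) v)"
    unfolding norm_of_real using n assms by simp
  then have "r * nrm v \<le> cmod (f (x + e) v) \<or> r * nrm v \<le> cmod (f (x - e) v)"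
    by linarith
  moreover have "nrm ((x + e) - x) \<le> r" "nrm ((x - e) - x) \<le> r"
    using ne nrm_minus[of e] by simp_all
  ultimately show ?thesis by blast
qed

text \<open>The gliding hump: the limit of points \<open>x\<^sub>n\<close> with \<open>\<parallel>x\<^sub>n\<^sub>+\<^sub>1 - x\<^sub>n\<parallel> \<le> 3\<^sup>-\<^sup>n\<close> stays within
  \<open>3\<^sup>-\<^sup>n / 2\<close> of \<open>x\<^sub>n\<^sub>+\<^sub>1\<close>, so it keeps half of the value gained in the \<open>n\<close>-th step.\<close>

lemma weakly_bounded_imp_bounded:
  assumes weak: "\<And>q. \<exists>c. \<forall>v\<in>V. cmod (f q v) \<le> c"
  shows "\<exists>C. \<forall>v\<in>V. nrm v \<le> C"
proof (rule ccontr)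
  assume "\<not> ?thesis"
  \<comment> \<open>The threshold makes half of the gain \<open>(1/3) ^ n * nrm (v n)\<close> exceed
    \<open>Suc n\<close>.\<close>
  then have "\<exists>v\<in>V. 2 * 3 ^ n * real (Suc n) < nrm v" for n
    by (meson not_le)
  then obtain v where vV: "\<And>n. v n \<in> V" and v: "\<And>n. 2 * 3 ^ n * real (Suc n) < nrm (v n)"
    by metis
  have v0: "v n \<noteq> 0" for n
  proof
    assume "v n = 0"
    with v[of n] have "2 * 3 ^ n * real (Suc n) < 0" by simp
    moreover have "0 \<le> (2::real) * 3 ^ n * real (Suc n)" by simp
    ultimately show False by linarith
  qed
  define step where "step n x x' \<longleftrightarrow>
    nrm (x' - x) \<le> (1/3) ^ n \<and> (1/3) ^ n * nrm (v n) \<le> cmod (f x' (v n))" for n x x'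
  have "\<exists>X. \<forall>n. step n (X n) (X (Suc n))"
    using dependent_nat_choice[of "\<lambda>_ _. True" step] unit_step[OF v0] unfolding step_def
    by auto
  then obtain X where dist: "\<And>n. nrm (X (Suc n) - X n) \<le> (1/3) ^ n"
    and gain: "\<And>n. (1/3) ^ n * nrm (v n) \<le> cmod (f (X (Suc n)) (v n))"
    unfolding step_def by blast
  \<comment> \<open>The bound is the exact sum of the geometric series from \<open>n\<close> to
    \<open>n + k - 1\<close>, which lets the induction telescope.\<close>
  have far: "nrm (X (n + k) - X n) \<le> 3/2 * (1/3) ^ n - 3/2 * (1/3) ^ (n + k)" for n k
  proof (induction k)
    case (Suc k)
    show ?case
      using Suc dist[of "n + k"] nrm_triangle_diff[of "X (n + Suc k)" "X n" "X (n + k)"]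
      by simp
  qed simp
  have far': "nrm (X m - X n) \<le> 3/2 * (1/3) ^ n" if "m \<ge> n" for m n
  proof -
    have "0 \<le> 3/2 * (1/3::real) ^ m" by simp
    moreover have "nrm (X m - X n) \<le> 3/2 * (1/3) ^ n - 3/2 * (1/3) ^ m"
      using far[of n "m - n"] that by simp
    ultimately show ?thesis by linarith
  qed
  have "kcauchy f J X"
    unfolding kcauchy_def
  proof (intro allI impI)
    fix e :: real assume "e > 0"
    then obtain N where N: "(1/3::real) ^ N < e / 3"
      using real_arch_pow_inv[of "e / 3" "1/3"] by auto
    have "nrm (X m - X n) < e" if "m \<ge> N" "n \<ge> N" for m n
      using far'[OF that(1)] far'[OF that(2)] N nrm_triangle_diff[of "X m" "X n" "X N"]
        nrm_minus_commute[of "X N" "X n"] by linarith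
    then show "\<exists>N. \<forall>m\<ge>N. \<forall>n\<ge>N. nrm (X m - X n) < e" by blast
  qed
  then obtain x where x: "kconverges f J X x" using complete by blast
  have close: "nrm (X n - x) \<le> 3/2 * (1/3) ^ n" for n
  proof (rule LIMSEQ_le_const)
    have "(\<lambda>m. 3/2 * (1/3) ^ n + nrm (X m - x)) \<longlonglongrightarrow> 3/2 * (1/3) ^ n + 0"
      using x unfolding kconverges_def by (intro tendsto_intros)
    then show "(\<lambda>m. 3/2 * (1/3) ^ n + nrm (X m - x)) \<longlonglongrightarrow> 3/2 * (1/3) ^ n" by simp
    have "nrm (X n - x) \<le> 3/2 * (1/3) ^ n + nrm (X m - x)" if "m \<ge> n" for m
      using far'[OF that] nrm_triangle_diff[of "X n" x "X m"] nrm_minus_commute[of "X n" "X m"]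
      by linarith
    then show "\<exists>N. \<forall>m\<ge>N. nrm (X n - x) \<le> 3/2 * (1/3) ^ n + nrm (X m - x)" by blast
  qed
  obtain c where c: "\<And>n. cmod (f x (v n)) \<le> c" using weak[of x] vV by blast
  have "real (Suc n) \<le> c" for n
  proof -
    \<comment> \<open>\<open>close\<close> at \<open>Suc n\<close> gives 3/2 times 1/3, that is half
      of the step length, so at most half of the gain is lost in the limit.\<close>
    have "cmod (f (X (Suc n) - x) (v n)) \<le> (1/2 * (1/3) ^ n) * nrm (v n)"
      using f_bound[of "X (Suc n) - x" "v n"] mult_right_mono[OF close[of "Suc n"], of "nrm (v n)"]
      by simp
    moreover have "cmod (f (X (Suc n)) (v n)) \<le> cmod (f (X (Suc n) - x) (v n)) + cmod (f x (v n))"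
      using norm_triangle_ineq[of "f (X (Suc n) - x) (v n)" "f x (v n)"] by (simp add: f_diff_left)
    moreover have "real (Suc n) \<le> 1/2 * (1/3) ^ n * nrm (v n)"
      using v[of n] by (simp add: field_simps)
    ultimately show ?thesis using gain[of n] c[of n] by linarith
  qed
  moreover obtain n where "c < real n" using reals_Archimedean2 by blast
  ultimately show False using of_nat_Suc[of n, where 'a = real] by (smt (verit))
qed

section \<open>Selfadjoint operators with a regular point\<close>

lemma kadj_D: "(y, z) \<in> kadj f H \<Longrightarrow> (x, w) \<in> H \<Longrightarrow> f w y = f x z"
  by (auto simp: kadj_def)

lemma kadj_diff:
  assumes "(y, z) \<in> kadj f H" "(y', z') \<in> kadj f H"
  shows "(y - y', z - z') \<in> kadj f H"
  using assms by (auto simp: kadj_def f_diff_right)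

lemma kadj_lin:
  assumes "(y, z) \<in> kadj f H" "(y', z') \<in> kadj f H"
  shows "(a *\<^sub>C y + y', a *\<^sub>C z + z') \<in> kadj f H"
  using assms by (auto simp: kadj_def f_add_right f_scale_right)

lemma kadj_closed:
  assumes "\<And>n. (X n, W n) \<in> kadj f H" "kconverges f J X x" "kconverges f J W w"
  shows "(x, w) \<in> kadj f H"
  unfolding kadj_def
proof (clarify)
  fix y v assume "(y, v) \<in> H"
  then have "(\<lambda>n. f v (X n)) = (\<lambda>n. f y (W n))"
    using kadj_D[OF assms(1)] by auto
  then show "f v x = f y w"
    using f_tendsto_right[OF assms(2), of v] f_tendsto_right[OF assms(3), of y]
    by (metis LIMSEQ_unique)
qed

lemma kadj_shift:
  assumes "(x, w) \<in> H" "(y, z) \<in> kadj f H"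
  shows "f (w - l *\<^sub>C x) y = f x (z - cnj l *\<^sub>C y)"
  using kadj_D[OF assms(2,1)] by (simp add: f_diff_left f_diff_right f_scale_left f_scale_right)

lemma orth_range:
  assumes "op_surj l H" "\<And>x w. (x, w) \<in> H \<Longrightarrow> f (w - l *\<^sub>C x) y = 0"
  shows "y = 0"
  using assms by (intro f_nondeg) (metis op_surj_def)

text \<open>The vectors \<open>v\<close> with \<open>\<parallel>(H - cnj l) v\<parallel> \<le> 1\<close> are weakly bounded because
  \<open>[(H - l) x, v] = [x, (H - cnj l) v]\<close>. Hence \<open>H - cnj l\<close> is bounded below and has closed range.\<close>

lemma selfadjoint_bounded_below:
  assumes sa: "kadj f H = H" and sur: "op_surj l H"
  shows "\<exists>C. \<forall>v w. (v, w) \<in> H \<longrightarrow> nrm v \<le> C * nrm (w - cnj l *\<^sub>C v)"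
proof -
  define V where "V = {v. \<exists>w. (v, w) \<in> H \<and> nrm (w - cnj l *\<^sub>C v) \<le> 1}"
  have "\<exists>C. \<forall>v\<in>V. nrm v \<le> C"
  proof (rule weakly_bounded_imp_bounded)
    fix q
    obtain x u where x: "(x, u) \<in> H" "u - l *\<^sub>C x = q" using sur unfolding op_surj_def by blast
    have "cmod (f q v) \<le> nrm x" if "v \<in> V" for v
    proof -
      obtain w where w: "(v, w) \<in> H" "nrm (w - cnj l *\<^sub>C v) \<le> 1" using \<open>v \<in> V\<close> unfolding V_def by blast
      have "f q v = f x (w - cnj l *\<^sub>C v)"
        using kadj_shift[of x u H v w l] x w sa by simp
      then have "cmod (f q v) \<le> nrm x * nrm (w - cnj l *\<^sub>C v)" using f_bound by simp
      also have "\<dots> \<le> nrm x * 1" using w(2) by (intro mult_left_mono) auto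
      finally show ?thesis by simp
    qed
    then show "\<exists>c. \<forall>v\<in>V. cmod (f q v) \<le> c" by blast
  qed
  then obtain C where C: "\<And>v. v \<in> V \<Longrightarrow> nrm v \<le> C" by blast
  have "nrm v \<le> C * nrm (w - cnj l *\<^sub>C v)" if vw: "(v, w) \<in> H" for v w
  proof (cases "w - cnj l *\<^sub>C v = 0")
    \<comment> \<open>A vector in the kernel of \<open>H - cnj l\<close> is orthogonal to the range
      of \<open>H - l\<close>, which is everything.\<close>
    case True
    have "v = 0"
    proof (rule orth_range[OF sur])
      fix x u assume "(x, u) \<in> H"
      then show "f (u - l *\<^sub>C x) v = 0"
        using kadj_shift[of x u H v w l] vw sa True by simp
    qed
    with True show ?thesis by simp
  next
    case False
    define r where "r = nrm (w - cnj l *\<^sub>C v)"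
    have r: "r > 0"
      using False nrm_nonneg[of "w - cnj l *\<^sub>C v"] nrm_eq_0_iff[of "w - cnj l *\<^sub>C v"]
      unfolding r_def by linarith
    let ?a = "of_real (1 / r) :: complex"
    have "(0, 0) \<in> kadj f H" by (auto simp: kadj_def)
    then have "(?a *\<^sub>C v, ?a *\<^sub>C w) \<in> H"
      using kadj_lin[of v w H 0 0 ?a] vw sa by simp
    moreover have "?a *\<^sub>C w - cnj l *\<^sub>C ?a *\<^sub>C v = ?a *\<^sub>C (w - cnj l *\<^sub>C v)"
      by (simp add: cscale_diff_right cscale_cscale mult.commute)
    then have "nrm (?a *\<^sub>C w - cnj l *\<^sub>C ?a *\<^sub>C v) \<le> 1"
      using r by (simp only: nrm_scale) (simp add: r_def[symmetric] norm_divide)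
    ultimately have "nrm (?a *\<^sub>C v) \<le> C" by (intro C) (auto simp: V_def)
    then have "nrm v / r \<le> C" using r by (simp add: nrm_scale norm_divide)
    then show ?thesis using r by (simp add: r_def[symmetric] pos_divide_le_eq)
  qed
  then show ?thesis by blast
qed

text \<open>The range \<open>S\<close> of \<open>H - cnj l\<close> is closed, since
  \<open>H - cnj l\<close> is bounded below and \<open>H\<close> is closed as an adjoint. A vector
  orthogonal to \<open>S\<close> lies in the kernel of \<open>H - l\<close> and is therefore zero,
  so \<open>S\<close> is everything.\<close>

lemma selfadjoint_surj_cnj:
  assumes sa: "kadj f H = H" and sur: "op_surj l H" and inj: "op_inj l H"
  shows "op_surj (cnj l) H"
  unfolding op_surj_def
proof
  fix y
  define S where "S = {w - cnj l *\<^sub>C v | v w. (v, w) \<in> H}"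
  obtain C where C: "\<And>v w. (v, w) \<in> H \<Longrightarrow> nrm v \<le> C * nrm (w - cnj l *\<^sub>C v)"
    using selfadjoint_bounded_below[OF sa sur] by blast
  have H0: "(0, 0) \<in> H" using sa by (auto simp: kadj_def)
  have Hlin: "(a *\<^sub>C v + v', a *\<^sub>C w + w') \<in> H" if "(v, w) \<in> H" "(v', w') \<in> H" for a v w v' w'
    using kadj_lin[of v w H v' w' a] that sa by simp
  have Slin: "a *\<^sub>C s + s' \<in> S" if "s \<in> S" "s' \<in> S" for a s s'
  proof -
    obtain v w v' w' where vw: "(v, w) \<in> H" "s = w - cnj l *\<^sub>C v"
      "(v', w') \<in> H" "s' = w' - cnj l *\<^sub>C v'"
      using \<open>s \<in> S\<close> \<open>s' \<in> S\<close> unfolding S_def by blast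
    have "a *\<^sub>C s + s' = (a *\<^sub>C w + w') - cnj l *\<^sub>C (a *\<^sub>C v + v')"
      using vw by (simp add: cscale_diff_right cscale_add_right cscale_cscale mult.commute)
    then show ?thesis using Hlin[OF vw(1,3)] unfolding S_def by blast
  qed
  have S0: "0 \<in> S" using H0 unfolding S_def by (intro CollectI exI[of _ 0]) simp
  have "csubspace S"
    unfolding csubspace_def using S0 Slin[of _ _ 1] Slin[OF _ S0] by (auto simp: cscale_one)
  moreover have "kclosed S"
    unfolding kclosed_def
  proof (intro allI impI)
    fix Y y assume Y: "\<forall>n. Y n \<in> S" and y: "kconverges f J Y y"
    have "\<forall>n. \<exists>v w. (v, w) \<in> H \<and> Y n = w - cnj l *\<^sub>C v" using Y unfolding S_def by blast
    then obtain V W where VW: "\<And>n. (V n, W n) \<in> H" "\<And>n. Y n = W n - cnj l *\<^sub>C V n" by metis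
    \<comment> \<open>The lower bound makes the preimages \<open>V n\<close> inherit the Cauchy
      property from the convergent images \<open>Y n\<close>.\<close>
    have diff: "nrm (V m - V n) \<le> C * nrm (Y m - Y n)" for m n
    proof -
      have "(V m - V n, W m - W n) \<in> H" using kadj_diff[of "V m" "W m" H] VW(1) sa by simp
      from C[OF this] show ?thesis by (simp add: VW(2) cscale_diff_right algebra_simps)
    qed
    have "kcauchy f J V"
      unfolding kcauchy_def
    proof (intro allI impI)
      fix e :: real assume "e > 0"
      \<comment> \<open>Replacing \<open>C\<close> by \<open>\<bar>C\<bar> + 1\<close> gives a
        positive divisor whatever the sign of \<open>C\<close>.\<close>
      define d where "d = e / (2 * (\<bar>C\<bar> + 1))"
      have d: "d > 0" using \<open>e > 0\<close> by (simp add: d_def)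
      obtain N where N: "\<And>n. n \<ge> N \<Longrightarrow> nrm (Y n - y) < d"
        using y order_tendstoD(2)[of _ 0 sequentially d] d unfolding kconverges_def
        by (auto simp: eventually_sequentially)
      have "nrm (V m - V n) < e" if "m \<ge> N" "n \<ge> N" for m n
      proof -
        have Yd: "nrm (Y m - Y n) < 2 * d"
          using N[OF that(1)] N[OF that(2)] nrm_triangle_diff[of "Y m" "Y n" y]
            nrm_minus_commute[of y "Y n"] by linarith
        have "C * nrm (Y m - Y n) \<le> (\<bar>C\<bar> + 1) * nrm (Y m - Y n)"
          by (intro mult_right_mono) auto
        also have "\<dots> < (\<bar>C\<bar> + 1) * (2 * d)" using Yd by (intro mult_strict_left_mono) auto
        also have "\<dots> = e" unfolding d_def by (simp add: field_simps)
        finally show ?thesis using diff[of m n] by linarith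
      qed
      then show "\<exists>N. \<forall>m\<ge>N. \<forall>n\<ge>N. nrm (V m - V n) < e" by blast
    qed
    then obtain v where v: "kconverges f J V v" using complete by blast
    have "kconverges f J W (y + cnj l *\<^sub>C v)"
      unfolding kconverges_def
    proof (rule tendsto_sandwich)
      show "\<forall>\<^sub>F n in sequentially. 0 \<le> nrm (W n - (y + cnj l *\<^sub>C v))" by simp
      have "nrm (W n - (y + cnj l *\<^sub>C v)) \<le> nrm (Y n - y) + cmod l * nrm (V n - v)" for n
      proof -
        have "W n - (y + cnj l *\<^sub>C v) = (Y n - y) + cnj l *\<^sub>C (V n - v)"
          by (simp add: VW(2) cscale_diff_right)
        then show ?thesis
          by (metis nrm_triangle nrm_scale complex_mod_cnj)
      qed
      then show "\<forall>\<^sub>F n in sequentially.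
          nrm (W n - (y + cnj l *\<^sub>C v)) \<le> nrm (Y n - y) + cmod l * nrm (V n - v)" by simp
      have "(\<lambda>n. nrm (Y n - y) + cmod l * nrm (V n - v)) \<longlonglongrightarrow> 0 + cmod l * 0"
        using y v unfolding kconverges_def by (intro tendsto_intros)
      then show "(\<lambda>n. nrm (Y n - y) + cmod l * nrm (V n - v)) \<longlonglongrightarrow> 0" by simp
    qed simp
    then have "(v, y + cnj l *\<^sub>C v) \<in> H"
      using kadj_closed[of V W H v] VW(1) v sa by simp
    then show "y \<in> S" unfolding S_def by force
  qed
  moreover have "f y u = 0" if u: "\<And>s. s \<in> S \<Longrightarrow> f s u = 0" for u
  proof -
    have "(u, l *\<^sub>C u) \<in> kadj f H"
      unfolding kadj_def
    proof clarify
      fix v w assume "(v, w) \<in> H"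
      then have "f (w - cnj l *\<^sub>C v) u = 0" by (intro u) (auto simp: S_def)
      then show "f w u = f v (l *\<^sub>C u)" by (simp add: f_diff_left f_scale_left f_scale_right)
    qed
    then have "u = 0" using inj sa unfolding op_inj_def by blast
    then show ?thesis by simp
  qed
  ultimately have "y \<in> S" by (rule f_projection)
  then show "\<exists>x w. (x, w) \<in> H \<and> w - cnj l *\<^sub>C x = y" unfolding S_def by blast
qed

text \<open>For \<open>(y, z)\<close> in the adjoint, solve (A - cnj l) v = z - cnj l y inside
  \<open>A\<close>. Symmetry makes \<open>y - v\<close> orthogonal to the range of
  \<open>A - l\<close>, so y = v.\<close>

lemma symmetric_selfadjoint:
  assumes sym: "A \<subseteq> kadj f A" and sur: "op_surj l A" and sur': "op_surj (cnj l) A"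
  shows "kadj f A = A"
proof
  show "kadj f A \<subseteq> A"
  proof clarify
    fix y z assume yz: "(y, z) \<in> kadj f A"
    obtain v w where vw: "(v, w) \<in> A" "w - cnj l *\<^sub>C v = z - cnj l *\<^sub>C y"
      using sur' unfolding op_surj_def by blast
    have "y - v = 0"
    proof (rule orth_range[OF sur])
      fix x u assume xu: "(x, u) \<in> A"
      have "(v, w) \<in> kadj f A" using vw(1) sym by blast
      then show "f (u - l *\<^sub>C x) (y - v) = 0"
        using kadj_shift[OF xu yz, of l] kadj_shift[OF xu, of v w l] vw(2)
        by (simp add: f_diff_right)
    qed
    then have "y = v" "z = w" using vw(2) by auto
    then show "(y, z) \<in> A" using vw(1) by simp
  qed
qed (rule sym)

text \<open>Write a vector \<open>u\<close> orthogonal to the domain as (A - cnj l) v. Then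
  [(A - l) x, v] = [x, u] = 0 for all \<open>x\<close> in the domain, so v = 0, and
  single-valuedness gives u = 0.\<close>

lemma symmetric_densely_defined:
  assumes sym: "A \<subseteq> kadj f A" and sur: "op_surj l A" and sur': "op_surj (cnj l) A"
    and sub: "csubspace (op_dom A)" and single: "\<And>w. (0, w) \<in> A \<Longrightarrow> w = 0"
  shows "densely_defined f J A"
  unfolding densely_defined_def
proof (intro allI impI dense_of_trivial_orthogonal[OF sub])
  fix u assume u: "\<And>s. s \<in> op_dom A \<Longrightarrow> f s u = 0"
  obtain v w where vw: "(v, w) \<in> A" "w - cnj l *\<^sub>C v = u"
    using sur' unfolding op_surj_def by blast
  have "v = 0"
  proof (rule orth_range[OF sur])
    fix x z assume xz: "(x, z) \<in> A"
    have "x \<in> op_dom A" using xz unfolding op_dom_def by force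
    then show "f (z - l *\<^sub>C x) v = 0"
      using kadj_shift[OF xz, of v w l] sym vw u by auto
  qed
  then show "u = 0" using vw single by simp
qed

end

section \<open>The product of a Krein space with itself\<close>

instantiation prod :: (cvector, cvector) cvector
begin

definition cscale_prod_def: "a *\<^sub>C p = (a *\<^sub>C fst p, a *\<^sub>C snd p)"

instance
  by standard
    (simp_all add: cscale_prod_def cscale_add_right cscale_add_left cscale_cscale cscale_one
      prod_eq_iff)

end

definition prod_form :: "('a::cvector \<Rightarrow> 'a \<Rightarrow> complex) \<Rightarrow> 'a \<times> 'a \<Rightarrow> 'a \<times> 'a \<Rightarrow> complex" where
  "prod_form f p q = f (fst p) (fst q) + f (snd p) (snd q)"

context krein
begin

lemma knorm_prod_sq:
  "(knorm (prod_form f) (map_prod J J) p)\<^sup>2 = (nrm (fst p))\<^sup>2 + (nrm (snd p))\<^sup>2"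
proof -
  have "Re (f (J x) x) = (nrm x)\<^sup>2" for x
    using ip_self[of x] by (simp add: ip_def)
  then show ?thesis
    unfolding knorm_def[of "prod_form f"] by (simp add: prod_form_def)
qed

lemma knorm_prod_nonneg: "0 \<le> knorm (prod_form f) (map_prod J J) p"
proof -
  have "0 \<le> Re (f (J x) x)" for x
    using ip_self[of x] by (simp add: ip_def)
  then show ?thesis by (simp add: knorm_def prod_form_def)
qed

lemma knorm_fst_le: "nrm (fst p) \<le> knorm (prod_form f) (map_prod J J) p"
  and knorm_snd_le: "nrm (snd p) \<le> knorm (prod_form f) (map_prod J J) p"
  by (rule power2_le_imp_le, simp_all add: knorm_prod_sq knorm_prod_nonneg)+

lemma knorm_prod_le: "knorm (prod_form f) (map_prod J J) p \<le> nrm (fst p) + nrm (snd p)"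
  by (rule power2_le_imp_le) (simp_all add: knorm_prod_sq power2_sum)

lemma kconverges_prod_iff:
  "kconverges (prod_form f) (map_prod J J) P p \<longleftrightarrow>
    kconverges f J (\<lambda>n. fst (P n)) (fst p) \<and> kconverges f J (\<lambda>n. snd (P n)) (snd p)"
  (is "?L \<longleftrightarrow> ?R1 \<and> ?R2")
proof (intro iffI conjI)
  assume L: ?L
  show ?R1 unfolding kconverges_def
    by (rule tendsto_sandwich[OF _ _ tendsto_const L[unfolded kconverges_def]])
      (use knorm_fst_le[of "_ - p"] in auto)
  show ?R2 unfolding kconverges_def
    by (rule tendsto_sandwich[OF _ _ tendsto_const L[unfolded kconverges_def]])
      (use knorm_snd_le[of "_ - p"] in auto)
next
  assume R: "?R1 \<and> ?R2"
  then have "(\<lambda>n. nrm (fst (P n) - fst p) + nrm (snd (P n) - snd p)) \<longlonglongrightarrow> 0 + 0"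
    unfolding kconverges_def by (intro tendsto_add) auto
  then have "(\<lambda>n. nrm (fst (P n) - fst p) + nrm (snd (P n) - snd p)) \<longlonglongrightarrow> 0" by simp
  from tendsto_sandwich[OF _ _ tendsto_const this] show ?L unfolding kconverges_def
    using knorm_prod_nonneg knorm_prod_le[of "_ - p"] by simp
qed

text \<open>Makes all results of the locale available on K x K, both for graphs as closed subspaces
  and for the block operator.\<close>

lemma krein_prod: "krein (prod_form f) (map_prod J J)"
proof
  have "hermitian_sesq (prod_form f)"
    unfolding hermitian_sesq_def prod_form_def
  proof (intro conjI allI)
    fix x y :: "'a \<times> 'a"
    show "f (fst x) (fst y) + f (snd x) (snd y) = cnj (f (fst y) (fst x) + f (snd y) (snd x))"
      using herm[of "fst x" "fst y"] herm[of "snd x" "snd y"] by simp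
  qed (simp add: cscale_prod_def f_add_left f_scale_left algebra_simps)
  moreover have "fundamental_symmetry (prod_form f) (map_prod J J)"
    unfolding fundamental_symmetry_def
  proof (intro conjI allI impI)
    fix x :: "'a \<times> 'a" assume "x \<noteq> 0"
    then have "fst x \<noteq> 0 \<or> snd x \<noteq> 0" by (simp add: prod_eq_iff)
    moreover have "0 \<le> Re (f (J z) z)" for z
      using ip_self[of z] by (simp add: ip_def)
    ultimately show "0 < Re (prod_form f (map_prod J J x) x)"
      using J_pos[of "fst x"] J_pos[of "snd x"]
      by (auto simp: prod_form_def intro: add_pos_nonneg add_nonneg_pos)
  qed (simp_all add: prod_form_def cscale_prod_def J_lin J_sym prod_eq_iff)
  moreover have "\<exists>l. kconverges (prod_form f) (map_prod J J) P l"
    if P: "kcauchy (prod_form f) (map_prod J J) P" for P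
  proof -
    have "kcauchy f J (\<lambda>n. fst (P n))"
      using P order.strict_trans1[OF knorm_fst_le] unfolding kcauchy_def
      by (simp flip: fst_diff) blast
    moreover have "kcauchy f J (\<lambda>n. snd (P n))"
      using P order.strict_trans1[OF knorm_snd_le] unfolding kcauchy_def
      by (simp flip: snd_diff) blast
    ultimately obtain a b where "kconverges f J (\<lambda>n. fst (P n)) a" "kconverges f J (\<lambda>n. snd (P n)) b"
      using complete by meson
    then show ?thesis
      by (intro exI[of _ "(a, b)"]) (simp add: kconverges_prod_iff)
  qed
  ultimately show "krein_space (prod_form f) (map_prod J J)"
    unfolding krein_space_def by blast
qed

lemma f_minus_left: "f (- x) z = - f x z"
  using f_diff_left[of 0 x z] by simp

lemma f_minus_right: "f z (- x) = - f z x"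
  using f_diff_right[of z 0 x] by simp

text \<open>View \<open>T\<close> as a closed subspace of K x K. If (u1, u2) is orthogonal to
  \<open>T\<close>, then (u2, -u1) belongs to the adjoint, so every element of the double adjoint is
  orthogonal to (u1, u2); \<open>f_projection\<close> puts it in \<open>T\<close>.\<close>

lemma kadj_kadj:
  assumes lin: "linear_op T" and cl: "closed_op f J T"
  shows "kadj f (kadj f T) = T"
proof
  show "T \<subseteq> kadj f (kadj f T)"
  proof clarify
    fix x w assume xw: "(x, w) \<in> T"
    have "f z x = f y w" if "(y, z) \<in> kadj f T" for y z
      using kadj_D[OF that xw] herm[of z x] herm[of y w] by simp
    then show "(x, w) \<in> kadj f (kadj f T)" unfolding kadj_def[of f "kadj f T"] by blast
  qed
  interpret P: krein "prod_form f" "map_prod J J" by (rule krein_prod)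
  show "kadj f (kadj f T) \<subseteq> T"
  proof clarify
    fix a d assume ad: "(a, d) \<in> kadj f (kadj f T)"
    show "(a, d) \<in> T"
    proof (rule P.f_projection)
      show "csubspace T"
        using lin unfolding csubspace_def linear_op_def
        by (auto simp: cscale_prod_def zero_prod_def)
      show "P.kclosed T"
        unfolding P.kclosed_def
      proof (intro allI impI)
        fix X l assume X: "\<forall>n. X n \<in> T" and l: "kconverges (prod_form f) (map_prod J J) X l"
        have "(fst l, snd l) \<in> T"
          using l X unfolding kconverges_prod_iff
          by (intro cl[unfolded closed_op_def, THEN spec, THEN spec, THEN spec, THEN spec,
              of "\<lambda>n. fst (X n)" "\<lambda>n. snd (X n)", THEN mp, THEN mp, THEN mp]) simp_all
        then show "l \<in> T" by simp
      qed
      fix u assume u: "\<And>s. s \<in> T \<Longrightarrow> prod_form f s u = 0"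
      have "(snd u, - fst u) \<in> kadj f T"
        unfolding kadj_def using u
        by (auto simp: prod_form_def f_minus_right eq_neg_iff_add_eq_0 add.commute)
      from kadj_D[OF ad this] have "f (snd u) d = - f (fst u) a" by (simp add: f_minus_left)
      then have "f a (fst u) + f d (snd u) = 0"
        using herm[of a "fst u"] herm[of d "snd u"] by simp
      then show "prod_form f (a, d) u = 0" by (simp add: prod_form_def)
    qed
  qed
qed

end

section \<open>The block operator\<close>

text \<open>The off-diagonal operator matrix with \<open>S\<close> in the upper right and
  \<open>T\<close> in the lower left corner.\<close>

definition block :: "('a::cvector \<times> 'a) set \<Rightarrow> ('a \<times> 'a) set \<Rightarrow> (('a \<times> 'a) \<times> 'a \<times> 'a) set" where
  "block S T = {((x, y), (x', y')). (y, x') \<in> S \<and> (x, y') \<in> T}"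

lemma csubspace_graph:
  assumes "csubspace S"
  shows "(0, 0) \<in> S"
    and "(x, w) \<in> S \<Longrightarrow> (y, v) \<in> S \<Longrightarrow> (x + y, w + v) \<in> S"
    and "(x, w) \<in> S \<Longrightarrow> (a *\<^sub>C x, a *\<^sub>C w) \<in> S"
    and "(x, w) \<in> S \<Longrightarrow> (y, v) \<in> S \<Longrightarrow> (x - y, w - v) \<in> S"
proof -
  have add: "p + q \<in> S" and scale: "b *\<^sub>C p \<in> S" if "p \<in> S" "q \<in> S" for p q b
    using assms that unfolding csubspace_def by blast+
  show "(0, 0) \<in> S" using assms by (simp add: csubspace_def zero_prod_def)
  show "(x, w) \<in> S \<Longrightarrow> (y, v) \<in> S \<Longrightarrow> (x + y, w + v) \<in> S"
    using add[of "(x, w)" "(y, v)"] by simp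
  show "(x, w) \<in> S \<Longrightarrow> (a *\<^sub>C x, a *\<^sub>C w) \<in> S"
    using scale[of "(x, w)" "(x, w)" a] by (simp add: cscale_prod_def)
  show "(x, w) \<in> S \<Longrightarrow> (y, v) \<in> S \<Longrightarrow> (x - y, w - v) \<in> S"
    using add[OF _ scale[of "(y, v)" "(y, v)" "- 1"], of "(x, w)"]
    by (simp add: cscale_prod_def cscale_minus_left cscale_one)
qed

lemma csubspace_graphI:
  assumes "(0, 0) \<in> S"
    and "\<And>x w y v. (x, w) \<in> S \<Longrightarrow> (y, v) \<in> S \<Longrightarrow> (x + y, w + v) \<in> S"
    and "\<And>a x w. (x, w) \<in> S \<Longrightarrow> (a *\<^sub>C x, a *\<^sub>C w) \<in> S"
  shows "csubspace S"
  using assms unfolding csubspace_def by (auto simp: zero_prod_def cscale_prod_def)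

lemma csubspace_op_comp:
  assumes "csubspace S" "csubspace T"
  shows "csubspace (op_comp S T)"
proof (rule csubspace_graphI)
  show "(0, 0) \<in> op_comp S T"
    using csubspace_graph(1)[OF assms(1)] csubspace_graph(1)[OF assms(2)]
    by (auto simp: op_comp_def)
next
  fix x w y v assume "(x, w) \<in> op_comp S T" "(y, v) \<in> op_comp S T"
  then show "(x + y, w + v) \<in> op_comp S T"
    unfolding op_comp_def
    by (auto dest: csubspace_graph(2)[OF assms(1)] csubspace_graph(2)[OF assms(2)])
next
  fix a x w assume "(x, w) \<in> op_comp S T"
  then show "(a *\<^sub>C x, a *\<^sub>C w) \<in> op_comp S T"
    unfolding op_comp_def
    by (auto dest: csubspace_graph(3)[OF assms(1), of _ _ a] csubspace_graph(3)[OF assms(2), of _ _ a])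
qed

lemma csubspace_op_dom:
  assumes "csubspace S"
  shows "csubspace (op_dom S)"
proof -
  have dom: "x \<in> op_dom S \<longleftrightarrow> (\<exists>w. (x, w) \<in> S)" for x
    by (force simp: op_dom_def)
  show ?thesis
    unfolding csubspace_def Ball_def dom using csubspace_graph(1-3)[OF assms] by meson
qed

text \<open>For \<open>y\<close> in the domain of \<open>S\<close>, the equation \<open>(T S - l) z = y\<close> is solved by
  \<open>z = (T u - y) / l\<close> where \<open>(S T - l) u = S y\<close>. A general right-hand side is reduced to this case
  by subtracting the solution of \<open>(T S - m) w = y\<close>, which lies in the domain of \<open>S\<close>.\<close>

lemma op_surj_swap:
  assumes S: "csubspace S" and T: "csubspace T"
    and surA: "op_surj l (op_comp S T)" and surB: "op_surj m (op_comp T S)" and "l \<noteq> 0"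
  shows "op_surj l (op_comp T S)"
  unfolding op_surj_def
proof
  fix y
  obtain w w' where "(w, w') \<in> op_comp T S" and y: "w' - m *\<^sub>C w = y"
    using surB unfolding op_surj_def by blast
  then obtain s where s: "(w, s) \<in> S" "(s, w') \<in> T" by (auto simp: op_comp_def)
  obtain u u' where "(u, u') \<in> op_comp S T" and u: "u' - l *\<^sub>C u = (l - m) *\<^sub>C s"
    using surA unfolding op_surj_def by blast
  then obtain t where t: "(u, t) \<in> T" "(t, u') \<in> S" by (auto simp: op_comp_def)
  define z where "z = (1 / l) *\<^sub>C (t - (l - m) *\<^sub>C w)"
  have "(t - (l - m) *\<^sub>C w, u' - (l - m) *\<^sub>C s) \<in> S"
    using csubspace_graph[OF S] t(2) s(1) by blast
  moreover have "u' - (l - m) *\<^sub>C s = l *\<^sub>C u" using u by (simp add: algebra_simps)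
  ultimately have "(z, (1 / l) *\<^sub>C l *\<^sub>C u) \<in> S"
    using csubspace_graph(3)[OF S] unfolding z_def by simp
  then have "(z, u) \<in> S" using \<open>l \<noteq> 0\<close> by (simp add: cscale_cscale cscale_one)
  then have "(z + w, t + w') \<in> op_comp T S"
    using csubspace_graph(2)[OF S _ s(1)] csubspace_graph(2)[OF T t(1) s(2)]
    unfolding op_comp_def by blast
  moreover have "l *\<^sub>C z = t - (l - m) *\<^sub>C w"
    using \<open>l \<noteq> 0\<close> unfolding z_def by (simp add: cscale_cscale cscale_one)
  then have "(t + w') - l *\<^sub>C (z + w) = y"
    using y by (simp add: cscale_add_right cscale_diff_left algebra_simps)
  ultimately show "\<exists>x w. (x, w) \<in> op_comp T S \<and> w - l *\<^sub>C x = y" by blast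
qed

text \<open>If T S y = l y, then s = S y satisfies S T s = l s, so s = 0 and l y = T 0 = 0.\<close>

lemma op_inj_swap:
  assumes S: "csubspace S" and single: "\<And>w. (0, w) \<in> T \<Longrightarrow> w = 0"
    and inj: "op_inj l (op_comp S T)" and "l \<noteq> 0"
  shows "op_inj l (op_comp T S)"
  unfolding op_inj_def
proof (intro allI impI)
  fix y assume "(y, l *\<^sub>C y) \<in> op_comp T S"
  then obtain s where s: "(y, s) \<in> S" "(s, l *\<^sub>C y) \<in> T" by (auto simp: op_comp_def)
  then have "(s, l *\<^sub>C s) \<in> op_comp S T"
    using csubspace_graph(3)[OF S] unfolding op_comp_def by blast
  then have "s = 0" using inj unfolding op_inj_def by blast
  then have "l *\<^sub>C y = 0" using s(2) single by blast
  then have "(1 / l) *\<^sub>C l *\<^sub>C y = 0" by simp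
  then show "y = 0" using \<open>l \<noteq> 0\<close> by (simp add: cscale_cscale cscale_one)
qed

text \<open>The square of the block operator is \<open>diag (S T, T S)\<close>, so that
  \<open>(block - \<mu>) (block + \<mu>) = diag (S T - \<mu>\<^sup>2, T S - \<mu>\<^sup>2)\<close>.\<close>

lemma block_surj:
  assumes S: "csubspace S" and T: "csubspace T"
    and surA: "op_surj (\<mu>\<^sup>2) (op_comp S T)" and surB: "op_surj (\<mu>\<^sup>2) (op_comp T S)"
  shows "op_surj \<mu> (block S T)"
  unfolding op_surj_def
proof
  fix pq :: "'a \<times> 'a"
  obtain p q where pq: "pq = (p, q)" by force
  obtain x w where "(x, w) \<in> op_comp S T" and p: "w - \<mu>\<^sup>2 *\<^sub>C x = p"
    using surA unfolding op_surj_def by blast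
  then obtain t where t: "(x, t) \<in> T" "(t, w) \<in> S" by (auto simp: op_comp_def)
  obtain y v where "(y, v) \<in> op_comp T S" and q: "v - \<mu>\<^sup>2 *\<^sub>C y = q"
    using surB unfolding op_surj_def by blast
  then obtain r where r: "(y, r) \<in> S" "(r, v) \<in> T" by (auto simp: op_comp_def)
  \<comment> \<open>The preimage is (block + \<open>\<mu>\<close>) applied to (x, y), where
    \<open>x\<close> and \<open>y\<close> solve the two diagonal equations.\<close>
  have "((r + \<mu> *\<^sub>C x, t + \<mu> *\<^sub>C y), (w + \<mu> *\<^sub>C r, v + \<mu> *\<^sub>C t)) \<in> block S T"
    using csubspace_graph[OF S] csubspace_graph[OF T] t r by (simp add: block_def)
  moreover have "(w + \<mu> *\<^sub>C r, v + \<mu> *\<^sub>C t) - \<mu> *\<^sub>C (r + \<mu> *\<^sub>C x, t + \<mu> *\<^sub>C y) = pq"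
    using p q by (simp add: pq cscale_prod_def cscale_add_right cscale_cscale power2_eq_square)
  ultimately show "\<exists>x w. (x, w) \<in> block S T \<and> w - \<mu> *\<^sub>C x = pq" by blast
qed

text \<open>Applying the block operator twice sends an eigenvector for \<open>\<mu>\<close> to its
  multiple by \<open>\<mu>\<^sup>2\<close>, so its components are in the kernels of the diagonal
  entries.\<close>

lemma block_inj:
  assumes S: "csubspace S" and T: "csubspace T"
    and injA: "op_inj (\<mu>\<^sup>2) (op_comp S T)" and injB: "op_inj (\<mu>\<^sup>2) (op_comp T S)"
  shows "op_inj \<mu> (block S T)"
  unfolding op_inj_def
proof (intro allI impI)
  fix v assume v: "(v, \<mu> *\<^sub>C v) \<in> block S T"
  obtain x y where xy: "v = (x, y)" by force
  have S1: "(y, \<mu> *\<^sub>C x) \<in> S" and T1: "(x, \<mu> *\<^sub>C y) \<in> T"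
    using v by (simp_all add: xy block_def cscale_prod_def)
  have S2: "(\<mu> *\<^sub>C y, \<mu>\<^sup>2 *\<^sub>C x) \<in> S"
    using csubspace_graph(3)[OF S S1, of \<mu>] by (simp add: cscale_cscale power2_eq_square)
  have T2: "(\<mu> *\<^sub>C x, \<mu>\<^sup>2 *\<^sub>C y) \<in> T"
    using csubspace_graph(3)[OF T T1, of \<mu>] by (simp add: cscale_cscale power2_eq_square)
  have "x = 0" using injA T1 S2 unfolding op_inj_def op_comp_def by blast
  moreover have "y = 0" using injB S1 T2 unfolding op_inj_def op_comp_def by blast
  ultimately show "v = 0" by (simp add: xy zero_prod_def)
qed

text \<open>Solve first with block - \<open>\<nu>\<close>, then with block + \<open>\<nu>\<close>.
  The intermediate vector (a, b) lies in the domain of the block operator, so the final solution (x,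
  y) lies in the domain of its square.\<close>

lemma op_surj_of_block:
  assumes S: "csubspace S" and T: "csubspace T"
    and sur: "op_surj \<nu> (block S T)" and sur': "op_surj (- \<nu>) (block S T)"
  shows "op_surj (\<nu>\<^sup>2) (op_comp S T)" and "op_surj (\<nu>\<^sup>2) (op_comp T S)"
proof -
  have "\<exists>x w y v. (x, w) \<in> op_comp S T \<and> w - \<nu>\<^sup>2 *\<^sub>C x = p
    \<and> (y, v) \<in> op_comp T S \<and> v - \<nu>\<^sup>2 *\<^sub>C y = q" for p q
  proof -
    obtain a b a' b' where ab: "((a, b), (a', b')) \<in> block S T"
      and "(a', b') - \<nu> *\<^sub>C (a, b) = (p, q)"
      using sur[unfolded op_surj_def, rule_format, of "(p, q)"] by auto
    then have pq: "a' - \<nu> *\<^sub>C a = p" "b' - \<nu> *\<^sub>C b = q" by (auto simp: cscale_prod_def)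
    obtain x y x' y' where xy: "((x, y), (x', y')) \<in> block S T"
      and "(x', y') - (- \<nu>) *\<^sub>C (x, y) = (a, b)"
      using sur'[unfolded op_surj_def, rule_format, of "(a, b)"] by auto
    then have a: "a = x' + \<nu> *\<^sub>C x" and b: "b = y' + \<nu> *\<^sub>C y"
      by (auto simp: cscale_prod_def cscale_minus_left)
    have mem: "(b, a') \<in> S" "(a, b') \<in> T" "(y, x') \<in> S" "(x, y') \<in> T"
      using ab xy by (auto simp: block_def)
    have "(b - \<nu> *\<^sub>C y, a' - \<nu> *\<^sub>C x') \<in> S" "(a - \<nu> *\<^sub>C x, b' - \<nu> *\<^sub>C y') \<in> T"
      using csubspace_graph(4)[OF S mem(1) csubspace_graph(3)[OF S mem(3)]]
        csubspace_graph(4)[OF T mem(2) csubspace_graph(3)[OF T mem(4)]] by blast+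
    then have "(y', a' - \<nu> *\<^sub>C x') \<in> S" "(x', b' - \<nu> *\<^sub>C y') \<in> T" by (simp_all add: a b)
    then have "(x, a' - \<nu> *\<^sub>C x') \<in> op_comp S T" "(y, b' - \<nu> *\<^sub>C y') \<in> op_comp T S"
      using mem by (auto simp: op_comp_def)
    moreover have "a' - \<nu> *\<^sub>C x' - \<nu>\<^sup>2 *\<^sub>C x = p" "b' - \<nu> *\<^sub>C y' - \<nu>\<^sup>2 *\<^sub>C y = q"
      using pq by (simp_all add: a b cscale_add_right cscale_cscale power2_eq_square diff_diff_eq)
    ultimately show ?thesis by blast
  qed
  then show "op_surj (\<nu>\<^sup>2) (op_comp S T)" "op_surj (\<nu>\<^sup>2) (op_comp T S)"
    unfolding op_surj_def by meson+
qed

section \<open>Products of an operator with its Krein space adjoint\<close>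

context krein
begin

lemma zero_mem_kadj: "(0, 0) \<in> kadj f H"
  by (simp add: kadj_def)

lemma block_selfadjoint:
  assumes lin: "linear_op T" and cl: "closed_op f J T"
  shows "kadj (prod_form f) (block (kadj f T) T) = block (kadj f T) T"
proof
  have T0: "(0, 0) \<in> T" using lin by (simp add: linear_op_def)
  show "kadj (prod_form f) (block (kadj f T) T) \<subseteq> block (kadj f T) T"
  proof clarify
    fix a b c d assume *: "((a, b), (c, d)) \<in> kadj (prod_form f) (block (kadj f T) T)"
    have eq: "f x' a + f y' b = f x c + f y d" if "(y, x') \<in> kadj f T" "(x, y') \<in> T" for x y x' y'
    proof -
      have "((x, y), (x', y')) \<in> block (kadj f T) T" using that by (simp add: block_def)
      with * have "prod_form f (x', y') (a, b) = prod_form f (x, y) (c, d)"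
        unfolding kadj_def[of "prod_form f"] by blast
      then show ?thesis by (simp add: prod_form_def)
    qed
    \<comment> \<open>Test vectors with one zero slot decouple \<open>eq\<close> into one adjoint
      relation for each corner of the matrix.\<close>
    have "(a, d) \<in> kadj f (kadj f T)"
      unfolding kadj_def[of f "kadj f T"] using eq[OF _ T0] by simp
    moreover have "(b, c) \<in> kadj f T"
      unfolding kadj_def using eq[OF zero_mem_kadj] by simp
    ultimately show "((a, b), (c, d)) \<in> block (kadj f T) T"
      unfolding kadj_kadj[OF lin cl] by (simp add: block_def)
  qed
  show "block (kadj f T) T \<subseteq> kadj (prod_form f) (block (kadj f T) T)"
  proof clarify
    fix a b c d assume "((a, b), (c, d)) \<in> block (kadj f T) T"
    then have bc: "(b, c) \<in> kadj f T" and ad: "(a, d) \<in> kadj f (kadj f T)"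
      unfolding kadj_kadj[OF lin cl] by (auto simp: block_def)
    show "((a, b), (c, d)) \<in> kadj (prod_form f) (block (kadj f T) T)"
      unfolding kadj_def[of "prod_form f"]
      using kadj_D[OF bc] kadj_D[OF ad] by (auto simp: block_def prod_form_def)
  qed
qed

lemma csubspace_kadj: "csubspace (kadj f T)"
  by (rule csubspace_graphI) (auto simp: kadj_def f_add_right f_scale_right)

text \<open>Both sides equal [T x, T y]. No linearity of \<open>T\<close> enters, so the result also
  applies with the adjoint in place of \<open>T\<close>.\<close>

lemma op_comp_symmetric: "op_comp (kadj f T) T \<subseteq> kadj f (op_comp (kadj f T) T)"
proof clarify
  fix y v assume "(y, v) \<in> op_comp (kadj f T) T"
  then obtain s where s: "(y, s) \<in> T" "(s, v) \<in> kadj f T" by (auto simp: op_comp_def)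
  have "f w y = f x v" if xw: "(x, w) \<in> op_comp (kadj f T) T" for x w
  proof -
    obtain t where t: "(x, t) \<in> T" "(t, w) \<in> kadj f T" using xw by (auto simp: op_comp_def)
    have "f w y = f t s"
      using kadj_D[OF t(2) s(1)] herm[of w y] herm[of t s] by simp
    also have "\<dots> = f x v" by (rule kadj_D[OF s(2) t(1)])
    finally show ?thesis .
  qed
  then show "(y, v) \<in> kadj f (op_comp (kadj f T) T)" unfolding kadj_def[of f "op_comp _ _"] by blast
qed

text \<open>Such a \<open>z\<close> is orthogonal to the domain. A domain vector \<open>d\<close>
  closer to \<open>J z\<close> than ||z|| would give ||z||^2 = [J z - d, z] < ||z||^2.\<close>

lemma kadj_single_valued:
  assumes "densely_defined f J T" "(0, z) \<in> kadj f T"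
  shows "z = 0"
proof (rule ccontr)
  assume "z \<noteq> 0"
  then have n: "nrm z > 0" using nrm_nonneg[of z] nrm_eq_0_iff[of z] by linarith
  then obtain d where d: "d \<in> op_dom T" "nrm (J z - d) < nrm z"
    using assms(1) unfolding densely_defined_def by blast
  then obtain w where "(d, w) \<in> T" by (auto simp: op_dom_def)
  then have "f d z = 0" using kadj_D[OF assms(2)] by fastforce
  then have "ip z z = f (J z - d) z" by (simp add: ip_def f_diff_left)
  then have "cmod (of_real ((nrm z)\<^sup>2)) \<le> nrm (J z - d) * nrm z"
    using f_bound[of "J z - d" z] unfolding ip_self by simp
  then have "(nrm z)\<^sup>2 \<le> nrm (J z - d) * nrm z" unfolding norm_of_real by simp
  also have "\<dots> < nrm z * nrm z" using d(2) n by simp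
  finally show False by (simp add: power2_eq_square)
qed

lemma resolvent_setD:
  assumes "l \<in> resolvent_set f J S" "(0, 0) \<in> S"
  shows "op_surj l S" "op_inj l S"
proof -
  have ex1: "\<exists>!x. \<exists>w. (x, w) \<in> S \<and> w - l *\<^sub>C x = y" for y
    using assms(1) unfolding resolvent_set_def by blast
  show "op_surj l S" unfolding op_surj_def using ex1 by blast
  show "op_inj l S"
    unfolding op_inj_def
  proof (intro allI impI)
    fix x assume "(x, l *\<^sub>C x) \<in> S"
    then have "\<exists>w. (x, w) \<in> S \<and> w - l *\<^sub>C x = 0" by force
    moreover have "\<exists>w. (0, w) \<in> S \<and> w - l *\<^sub>C 0 = 0" using assms(2) by force
    ultimately show "x = 0" using ex1[of 0] by blast
  qed
qed

lemma products_surj_cnj: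
  assumes lin: "linear_op T" and cl: "closed_op f J T"
    and A: "op_surj l (op_comp (kadj f T) T)" "op_inj l (op_comp (kadj f T) T)"
    and B: "op_surj l (op_comp T (kadj f T))" "op_inj l (op_comp T (kadj f T))"
  shows "op_surj (cnj l) (op_comp (kadj f T) T)" and "op_surj (cnj l) (op_comp T (kadj f T))"
proof -
  interpret P: krein "prod_form f" "map_prod J J" by (rule krein_prod)
  have T: "csubspace T"
    using lin unfolding linear_op_def by (intro csubspace_graphI) blast+
  define \<mu> where "\<mu> = csqrt l"
  have \<mu>: "\<mu>\<^sup>2 = l" "(- \<mu>)\<^sup>2 = l" by (simp_all add: \<mu>_def)
  \<comment> \<open>Needed for both square roots of \<open>l\<close>, since the two factors of the
    squared block operator minus \<open>cnj l\<close> must be surjective.\<close>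
  have cnj: "op_surj (cnj \<nu>) (block (kadj f T) T)" if "\<nu>\<^sup>2 = l" for \<nu>
    using block_selfadjoint[OF lin cl] A B that
    by (intro P.selfadjoint_surj_cnj block_surj block_inj csubspace_kadj T) simp_all
  have "(cnj \<mu>)\<^sup>2 = cnj l" using \<mu> by (metis complex_cnj_power)
  then show "op_surj (cnj l) (op_comp (kadj f T) T)" "op_surj (cnj l) (op_comp T (kadj f T))"
    using op_surj_of_block[OF csubspace_kadj T cnj[OF \<mu>(1)]] cnj[OF \<mu>(2)] by simp_all
qed

end

section \<open>A common regular point and the conclusion\<close>

theorem theorem2p1:
  fixes f :: "'a::cvector \<Rightarrow> 'a \<Rightarrow> complex" and J :: "'a \<Rightarrow> 'a"
    and T :: "('a \<times> 'a) set"
  assumes "krein_space f J"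
    and "linear_op T" and "closed_op f J T" and "densely_defined f J T"
    and "resolvent_set f J (op_comp (kadj f T) T) \<noteq> {}"
    and "resolvent_set f J (op_comp T (kadj f T)) \<noteq> {}"
  shows "densely_defined f J (op_comp (kadj f T) T)
       \<and> kadj f (op_comp (kadj f T) T) = op_comp (kadj f T) T
       \<and> densely_defined f J (op_comp T (kadj f T))
       \<and> kadj f (op_comp T (kadj f T)) = op_comp T (kadj f T)"
proof -
  interpret krein f J by standard (rule assms(1))
  let ?S = "kadj f T"
  let ?A = "op_comp ?S T" and ?B = "op_comp T ?S"
  have S: "csubspace ?S" by (rule csubspace_kadj)
  have T: "csubspace T"
    using assms(2) unfolding linear_op_def by (intro csubspace_graphI) blast+
  have A0: "csubspace ?A" and B0: "csubspace ?B" using S T by (simp_all add: csubspace_op_comp)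
  have singleT: "\<And>w. (0, w) \<in> T \<Longrightarrow> w = 0" using assms(2) by (simp add: linear_op_def)
  have singleS: "\<And>w. (0, w) \<in> ?S \<Longrightarrow> w = 0" using kadj_single_valued[OF assms(4)] by blast
  obtain a b where "a \<in> resolvent_set f J ?A" "b \<in> resolvent_set f J ?B" using assms(5,6) by blast
  then have a: "op_surj a ?A" "op_inj a ?A" and b: "op_surj b ?B" "op_inj b ?B"
    using resolvent_setD csubspace_graph(1) A0 B0 by blast+
  \<comment> \<open>The two given points may differ. A nonzero one transfers to the other product by
    the swap lemmas; if both are zero, they already agree.\<close>
  obtain l where A: "op_surj l ?A" "op_inj l ?A" and B: "op_surj l ?B" "op_inj l ?B"
  proof (cases "a = 0")
    case False
    then have "op_surj a ?B" "op_inj a ?B"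
      using op_surj_swap[OF S T a(1) b(1)] op_inj_swap[OF S singleT a(2)] by blast+
    with a that show ?thesis by blast
  next
    case a0: True
    show ?thesis
    proof (cases "b = 0")
      case True
      with a0 a b that show ?thesis by blast
    next
      case False
      then have "op_surj b ?A" "op_inj b ?A"
        using op_surj_swap[OF T S b(1) a(1)] op_inj_swap[OF T singleS b(2)] by blast+
      with b that show ?thesis by blast
    qed
  qed
  note cnj = products_surj_cnj[OF assms(2,3) A B]
  have symA: "?A \<subseteq> kadj f ?A" by (rule op_comp_symmetric)
  \<comment> \<open>The second product is the first one formed from \<open>?S\<close>, because the
    double adjoint of \<open>T\<close> is \<open>T\<close>.\<close>
  have symB: "?B \<subseteq> kadj f ?B"
    using op_comp_symmetric[of ?S] unfolding kadj_kadj[OF assms(2,3)] .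
  have "densely_defined f J ?A" "densely_defined f J ?B"
    using symmetric_densely_defined[OF symA A(1) cnj(1) csubspace_op_dom[OF A0]]
      symmetric_densely_defined[OF symB B(1) cnj(2) csubspace_op_dom[OF B0]] singleS singleT
    by (auto simp: op_comp_def)
  then show ?thesis
    using symmetric_selfadjoint[OF symA A(1) cnj(1)] symmetric_selfadjoint[OF symB B(1) cnj(2)]
    by blast
qed

end
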